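(* Let $A$ be a partially ordered set with $N$ elements, $\Xi_N=\{\xi_1<\dots<\xi_N\}\subset\Xi$, $B=\{\beta_1,\dots,\beta_n\}\subset A$ a set of $n\le N$ distinct elements, and let $F$, $F_\pi$, $S(B,f)$, $T_{\pi,k}$, $T^{\pi,k}$ be as defined in the context. For each permutation $\pi$ of $\{1,\dots,n\}$ such that $$1\le k,j\le n,\ \beta_{\pi(k)}\prec\beta_{\pi(j)}\implies k<j,\qquad ( * )$$ one has $$\min_{f\in F_\pi}S(B,f)=\sum_{k=1}^n\xi_{|T_{\pi,k}|}\quad\text{and}\quad \max_{f\in F_\pi}S(B,f)=\sum_{k=1}^n\xi_{N-|T^{\pi,k}|+1}.$$ If $f_*$ and $f^*$ are functions in $F_\pi$ on which this minimum and this maximum are attained respectively, then for $k=1,\dots,n$ $$f_*(\beta_{\pi(k)})=\xi_{|T_{\pi,k}|}\quad\text{and}\quad f^*(\beta_{\pi(k)})=\xi_{N-|T^{\pi,k}|+1}.$$ Hence $$\min_{f\in F}S(B,f)=\min_\pi\sum_{k=1}^n\xi_{|T_{\pi,k}|}\quad\text{and}\quad \max_{f\in F}S(B,f)=\max_\pi\sum_{k=1}^n\xi_{N-|T^{\pi,k}|+1},$$ where the minimum and the maximum on the right-hand sides are taken over all permutations $\pi$ of $\{1,\dots,n\}$ that satisfy $( * )$.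
   Context: $N\in\mathbb{N}$ and $A=\{\alpha_1,\dots,\alpha_N\}$ is a set of $N$ elements with a partial order $\preceq$; $\alpha\prec\beta$ means $\alpha\preceq\beta$ and $\alpha\ne\beta$. $\Xi$ is a linearly ordered set with order $\le$ and a commutative associative binary operation $+$ such that for all $\xi,\eta,\zeta\in\Xi$, $\xi<\eta$ implies $\xi+\zeta<\eta+\zeta$. $\Xi_N=\{\xi_1,\dots,\xi_N\}\subset\Xi$ is a subset of $N$ different elements $\xi_1<\xi_2<\dots<\xi_N$. $F$ is the set of all bijections $f\colon A\to\Xi_N$ that are non-decreasing, i.e. $\alpha\preceq\beta$ implies $f(\alpha)\le f(\beta)$. For $f\in F$, $S(B,f)=\sum_{k=1}^n f(\beta_k)$ (sum with respect to $+$ in $\Xi$). Here $|C|$ is the number of elements of a finite set $C$. For $k=1,\dots,n$ set $\Pi_k=\{\beta\in A\colon\beta\preceq\beta_k\}$ and $\Pi^k=\{\beta\in A\colon\beta_k\preceq\beta\}$. For a permutation $\pi$ of $\{1,\dots,n\}$ and $k=1,\dots,n$ set $$T_{\pi,k}=\bigcup_{j=1}^k\Pi_{\pi(j)},\qquad T^{\pi,k}=\bigcup_{j=k}^n\Pi^{\pi(j)}.$$ For a permutation $\pi$ satisfying $( * )$, $F_\pi=\{f\in F\colon f(\beta_{\pi(1)})<\dots<f(\beta_{\pi(n)})\}$. *)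

theory Defs
  imports Complex_Main "HOL-Library.FuncSet" "HOL-Combinatorics.Permutations"
begin

text \<open>
  A commutative semigroup need not contain a zero, so \<^const>\<open>sum\<close> is not available: the empty sum
  (case \<open>0\<close>) has no meaning and is left unspecified. For nonempty sums in a commutative monoid
  this is the usual sum, see \<open>semigroup_sum_eq_sum\<close>.
\<close>

fun semigroup_sum :: "(nat \<Rightarrow> 'x::ab_semigroup_add) \<Rightarrow> nat \<Rightarrow> 'x" where
  "semigroup_sum g 0 = undefined"
| "semigroup_sum g (Suc 0) = g 1"
| "semigroup_sum g (Suc (Suc n)) = semigroup_sum g (Suc n) + g (Suc (Suc n))"

lemma semigroup_sum_eq_sum:
  fixes g :: "nat \<Rightarrow> 'x::comm_monoid_add"
  assumes "1 \<le> n"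
  shows "semigroup_sum g n = (\<Sum>k = 1..n. g k)"
  using assms by (induction g n rule: semigroup_sum.induct) (auto simp: add.commute)

text \<open>
  The order on \<open>A\<close> is a relation \<open>r\<close>, with \<open>(a, b) \<in> r\<close> for \<open>a \<preceq> b\<close>. Functions on \<open>A\<close> are taken
  extensional, so that \<open>F\<close> is the (finite) set of functions with domain exactly \<open>A\<close>.
\<close>

definition F :: "'a set \<Rightarrow> 'a rel \<Rightarrow> nat \<Rightarrow> (nat \<Rightarrow> 'x::linorder) \<Rightarrow> ('a \<Rightarrow> 'x) set" where
  "F A r N \<xi> = {f \<in> extensional A. bij_betw f A (\<xi> ` {1..N}) \<and>
     (\<forall>a\<in>A. \<forall>b\<in>A. (a, b) \<in> r \<longrightarrow> f a \<le> f b)}"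

definition S :: "(nat \<Rightarrow> 'a) \<Rightarrow> nat \<Rightarrow> ('a \<Rightarrow> 'x::ab_semigroup_add) \<Rightarrow> 'x" where
  "S \<beta> n f = semigroup_sum (\<lambda>k. f (\<beta> k)) n"

definition lower_cone :: "'a set \<Rightarrow> 'a rel \<Rightarrow> 'a \<Rightarrow> 'a set" where
  "lower_cone A r b = {a \<in> A. (a, b) \<in> r}"

definition upper_cone :: "'a set \<Rightarrow> 'a rel \<Rightarrow> 'a \<Rightarrow> 'a set" where
  "upper_cone A r b = {a \<in> A. (b, a) \<in> r}"

definition T_lower :: "'a set \<Rightarrow> 'a rel \<Rightarrow> (nat \<Rightarrow> 'a) \<Rightarrow> (nat \<Rightarrow> nat) \<Rightarrow> nat \<Rightarrow> 'a set" where
  "T_lower A r \<beta> \<pi> k = (\<Union>j\<in>{1..k}. lower_cone A r (\<beta> (\<pi> j)))"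

definition T_upper :: "'a set \<Rightarrow> 'a rel \<Rightarrow> (nat \<Rightarrow> 'a) \<Rightarrow> nat \<Rightarrow> (nat \<Rightarrow> nat) \<Rightarrow> nat \<Rightarrow> 'a set" where
  "T_upper A r \<beta> n \<pi> k = (\<Union>j\<in>{k..n}. upper_cone A r (\<beta> (\<pi> j)))"

definition admissible_perms :: "'a rel \<Rightarrow> (nat \<Rightarrow> 'a) \<Rightarrow> nat \<Rightarrow> (nat \<Rightarrow> nat) set" where
  "admissible_perms r \<beta> n = {\<pi>. \<pi> permutes {1..n} \<and>
     (\<forall>k\<in>{1..n}. \<forall>j\<in>{1..n}.
        (\<beta> (\<pi> k), \<beta> (\<pi> j)) \<in> r \<and> \<beta> (\<pi> k) \<noteq> \<beta> (\<pi> j) \<longrightarrow> k < j)}"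

definition F_perm :: "'a set \<Rightarrow> 'a rel \<Rightarrow> nat \<Rightarrow> (nat \<Rightarrow> 'x::linorder) \<Rightarrow> (nat \<Rightarrow> 'a) \<Rightarrow> nat \<Rightarrow>
    (nat \<Rightarrow> nat) \<Rightarrow> ('a \<Rightarrow> 'x) set" where
  "F_perm A r N \<xi> \<beta> n \<pi> = {f \<in> F A r N \<xi>. strict_mono_on {1..n} (\<lambda>k. f (\<beta> (\<pi> k)))}"

end

theory Submission
  imports Defs
begin

text \<open>
  Write \<open>f = \<xi> \<circ> g\<close> with a rank function \<open>g\<close>, a bijection onto \<open>{1..N}\<close>. For \<open>f \<in> F\<^sub>\<pi>\<close> every element
  of \<open>T\<^sub>\<pi>\<^sub>,\<^sub>k\<close> has rank at most that of \<open>\<beta>\<^bsub>\<pi>(k)\<^esub>\<close>, so this rank is at least the cardinality of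
  \<open>T\<^sub>\<pi>\<^sub>,\<^sub>k\<close>. A linear extension listing \<open>T\<^sub>\<pi>\<^sub>,\<^sub>1\<close>, then \<open>T\<^sub>\<pi>\<^sub>,\<^sub>2 - T\<^sub>\<pi>\<^sub>,\<^sub>1\<close>, and so on attains all these
  bounds simultaneously, and strict monotonicity of addition makes it the only way to attain the
  minimal sum. The maximum is dual, and \<open>F\<close> is the union of the sets \<open>F\<^sub>\<pi>\<close>.
\<close>

section \<open>Nonempty sums in a commutative semigroup\<close>

lemma semigroup_sum_Suc:
  "n \<ge> 1 \<Longrightarrow> semigroup_sum g (Suc n) = semigroup_sum g n + g (Suc n)"
  by (cases n) auto

lemma semigroup_sum_cong:
  assumes "\<And>k. k \<in> {1..n} \<Longrightarrow> g k = h k"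
  shows "semigroup_sum g n = semigroup_sum h n"
  using assms by (induction g n rule: semigroup_sum.induct) auto

text \<open>
  Adjoining a neutral element turns the semigroup into a commutative monoid, where sums over sets
  may be reindexed.
\<close>

lemma semigroup_sum_permute:
  fixes g :: "nat \<Rightarrow> 'x::ab_semigroup_add"
  assumes \<pi>: "\<pi> permutes {1..n}"
  shows "semigroup_sum (\<lambda>k. g (\<pi> k)) n = semigroup_sum g n"
proof (cases "n = 0")
  case False
  define plus' :: "'x option \<Rightarrow> 'x option \<Rightarrow> 'x option" where
    "plus' = (\<lambda>a b. case a of None \<Rightarrow> b
      | Some x \<Rightarrow> (case b of None \<Rightarrow> a | Some y \<Rightarrow> Some (x + y)))"
  interpret M: comm_monoid_set plus' None
    by unfold_locales (auto simp: plus'_def add_ac split: option.splits)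
  \<comment> \<open>The restriction to \<open>m \<ge> 1\<close> matters: over the empty index set
    the set sum is \<open>None\<close>, whereas \<open>semigroup_sum\<close> at \<open>0\<close> is
    \<open>undefined\<close>.\<close>
  have eq: "Some (semigroup_sum h m) = M.F (\<lambda>k. Some (h k)) {1..m}" if "m \<ge> 1"
    for h :: "nat \<Rightarrow> 'x" and m
    using that
  proof (induction m rule: nat_induct_at_least)
    case base
    show ?case by (simp add: plus'_def)
  next
    case (Suc m)
    have IH: "M.F (\<lambda>k. Some (h k)) {1..m} = Some (semigroup_sum h m)"
      using Suc.IH by simp
    have "M.F (\<lambda>k. Some (h k)) {1..Suc m} = plus' (Some (h (Suc m))) (M.F (\<lambda>k. Some (h k)) {1..m})"
      by (simp add: atLeastAtMostSuc_conv)
    then show ?case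
      using Suc.hyps by (simp only: IH) (simp add: semigroup_sum_Suc plus'_def add.commute)
  qed
  have "bij_betw \<pi> {1..n} {1..n}"
    using \<pi> by (rule permutes_imp_bij)
  then have "M.F (\<lambda>k. Some (g (\<pi> k))) {1..n} = M.F (\<lambda>k. Some (g k)) {1..n}"
    by (rule M.reindex_bij_betw)
  moreover have "n \<ge> 1"
    using False by simp
  ultimately show ?thesis
    by (metis eq option.inject)
qed simp

section \<open>Monotonicity of sums, with the compatibility of order and addition as a local
  assumption\<close>

context
  assumes add_strict: "\<And>x y z :: 'x::{linorder, ab_semigroup_add}. x < y \<Longrightarrow> x + z < y + z"
begin

lemma add_mono_of_strict:
  fixes a b c d :: 'x
  assumes "a \<le> b" "c \<le> d"
  shows "a + c \<le> b + d"
proof -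
  have right: "x + z \<le> y + z" if "x \<le> y" for x y z :: 'x
    using that add_strict[of x y z] by (auto simp: order_le_less)
  have "a + c \<le> b + c"
    using assms(1) by (rule right)
  also have "\<dots> \<le> b + d"
    using right[OF assms(2), of b] by (simp only: add.commute)
  finally show ?thesis .
qed

lemma semigroup_sum_mono:
  fixes g h :: "nat \<Rightarrow> 'x"
  assumes "\<And>k. k \<in> {1..n} \<Longrightarrow> g k \<le> h k"
  shows "semigroup_sum g n \<le> semigroup_sum h n"
  using assms by (induction g n rule: semigroup_sum.induct) (auto intro!: add_mono_of_strict)

lemma semigroup_sum_strict_mono:
  fixes g h :: "nat \<Rightarrow> 'x"
  assumes "\<And>k. k \<in> {1..n} \<Longrightarrow> g k \<le> h k" and "i \<in> {1..n}" and "g i < h i"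
  shows "semigroup_sum g n < semigroup_sum h n"
  using assms
proof (induction n)
  case (Suc n)
  show ?case
  proof (cases "n = 0")
    case True
    then show ?thesis using Suc.prems by auto
  next
    case False
    then have sums: "semigroup_sum g (Suc n) = semigroup_sum g n + g (Suc n)"
      "semigroup_sum h (Suc n) = semigroup_sum h n + h (Suc n)"
      by (simp_all add: semigroup_sum_Suc)
    show ?thesis
    proof (cases "i = Suc n")
      case True
      have "semigroup_sum g n + g (Suc n) < semigroup_sum g n + h (Suc n)"
        using Suc.prems(3) True by (metis add_strict add.commute)
      also have "\<dots> \<le> semigroup_sum h n + h (Suc n)"
        using Suc.prems(1) by (intro add_mono_of_strict semigroup_sum_mono) auto
      finally show ?thesis by (simp only: sums)
    next
      case False
      have "semigroup_sum g n + g (Suc n) \<le> semigroup_sum g n + h (Suc n)"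
        using Suc.prems(1) by (intro add_mono_of_strict) auto
      also have "\<dots> < semigroup_sum h n + h (Suc n)"
        using Suc.prems False by (intro add_strict Suc.IH) auto
      finally show ?thesis by (simp only: sums)
    qed
  qed
qed simp

text \<open>A single strict inequality among the terms would make the sums differ. This turns
  attainment of an extremal sum into equality of all terms, hence into uniqueness of the extremal
  values.\<close>

lemma semigroup_sum_eq_imp_eq:
  fixes g h :: "nat \<Rightarrow> 'x"
  assumes "\<And>k. k \<in> {1..n} \<Longrightarrow> g k \<le> h k" and "semigroup_sum g n = semigroup_sum h n"
    and "i \<in> {1..n}"
  shows "g i = h i"
  using semigroup_sum_strict_mono[of n g h i] assms by (metis order_le_less less_irrefl)

end

section \<open>Linear extensions of a finite partial order\<close>

text \<open>Induction on the cardinality: an element that is \<open>r\<close>-maximal among those of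
  largest key receives the top rank and is removed. The key allows one construction to serve three
  ends: a layered key gives extremal ranks, a constant key gives a plain linear extension, and the
  empty relation gives sorting by the key.\<close>

lemma linear_extension_with_key:
  fixes key :: "'a \<Rightarrow> 'k::linorder"
  assumes "finite A" and "antisym r"
    and "trans r"
    and "\<And>a b. a \<in> A \<Longrightarrow> b \<in> A \<Longrightarrow> (a, b) \<in> r \<Longrightarrow> key a \<le> key b"
  shows "\<exists>g. bij_betw g A {1..card A} \<and>
    (\<forall>a\<in>A. \<forall>b\<in>A. (a, b) \<in> r \<or> key a < key b \<longrightarrow> g a \<le> g b)"
  using assms(1,4)
proof (induction "card A" arbitrary: A)
  case 0
  then show ?case by (auto simp: bij_betw_def)
next
  case (Suc m)
  define K where "K = {a \<in> A. key a = Max (key ` A)}"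
  have "A \<noteq> {}" "finite A"
    using Suc.hyps(2) Suc.prems(1) by auto
  then have "Max (key ` A) \<in> key ` A"
    by (intro Max_in) auto
  then have "K \<noteq> {}"
    by (auto simp: K_def)
  moreover have "finite K"
    using \<open>finite A\<close> by (simp add: K_def)
  moreover have "asymp_on K (\<lambda>a b. (a, b) \<in> r \<and> a \<noteq> b)"
    using \<open>antisym r\<close> by (auto simp: asymp_on_def dest: antisymD)
  moreover have "transp_on K (\<lambda>a b. (a, b) \<in> r \<and> a \<noteq> b)"
    using \<open>antisym r\<close> \<open>trans r\<close> by (auto simp: transp_on_def dest: antisymD transD)
  ultimately have "\<exists>x\<in>K. \<forall>y\<in>K. y \<noteq> x \<longrightarrow> \<not> ((x, y) \<in> r \<and> x \<noteq> y)"
    by (intro Finite_Set.bex_max_element)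
  then obtain x where x: "x \<in> K" "\<And>y. y \<in> K \<Longrightarrow> (x, y) \<in> r \<Longrightarrow> y = x"
    by metis
  have "x \<in> A" and key_le: "\<And>a. a \<in> A \<Longrightarrow> key a \<le> key x"
    using x(1) \<open>finite A\<close> by (auto simp: K_def)
  \<comment> \<open>Nothing has a larger key than \<open>x\<close>, and anything above
    \<open>x\<close> in \<open>r\<close> has at least its key, so lies in \<open>K\<close>, where
    \<open>x\<close> is maximal. Hence the top rank for \<open>x\<close> violates no
    constraint.\<close>
  have top: "a = x" if "a \<in> A" "(x, a) \<in> r \<or> key x < key a" for a
  proof -
    have "key a = key x"
      using that key_le[OF that(1)] Suc.prems(2)[OF \<open>x \<in> A\<close> that(1)] by auto
    then show ?thesis
      using that x by (auto simp: K_def)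
  qed
  have m: "m = card (A - {x})"
    using Suc.hyps(2) \<open>x \<in> A\<close> \<open>finite A\<close> by simp
  then obtain g where g: "bij_betw g (A - {x}) {1..m}"
    "\<And>a b. a \<in> A - {x} \<Longrightarrow> b \<in> A - {x} \<Longrightarrow> (a, b) \<in> r \<or> key a < key b \<Longrightarrow> g a \<le> g b"
    using Suc.hyps(1)[OF m] Suc.prems by blast
  define g' where "g' = g(x := Suc m)"
  have g_le: "g a \<le> m" if "a \<in> A - {x}" for a
    using g(1) that by (auto simp: bij_betw_def)
  have "bij_betw g' (A - {x}) {1..m}"
    using g(1) by (rule bij_betw_cong[THEN iffD1, rotated]) (auto simp: g'_def)
  then have "bij_betw g' (A - {x} \<union> {x}) ({1..m} \<union> {g' x})"
    by (rule notIn_Un_bij_betw[rotated 2]) (auto simp: g'_def)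
  moreover have "A - {x} \<union> {x} = A" "{1..m} \<union> {g' x} = {1..card A}"
    using \<open>x \<in> A\<close> by (auto simp: g'_def simp flip: Suc.hyps(2))
  ultimately have "bij_betw g' A {1..card A}"
    by simp
  moreover have "g' a \<le> g' b" if "a \<in> A" "b \<in> A" "(a, b) \<in> r \<or> key a < key b" for a b
    using that g(2)[of a b] g_le[of a] top[of b] by (cases "a = x"; cases "b = x") (auto simp: g'_def)
  ultimately show ?case
    by blast
qed

section \<open>Extremal linear extensions along a chain-compatible sequence\<close>

text \<open>
  The key lists the elements of each new layer \<open>T\<^sub>k - T\<^sub>k\<^sub>-\<^sub>1\<close> consecutively, with \<open>b k\<close> last.
\<close>

lemma least_ranks_along_chain:
  fixes b :: "nat \<Rightarrow> 'a"
  assumes "finite A" and "partial_order_on A r"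
    and inj: "inj_on b {1..n}" and sub: "b ` {1..n} \<subseteq> A"
    and chain: "\<And>i j. i \<in> {1..n} \<Longrightarrow> j \<in> {1..n} \<Longrightarrow> (b i, b j) \<in> r \<Longrightarrow> i \<le> j"
  defines "T \<equiv> \<lambda>k. \<Union>j\<in>{1..k}. lower_cone A r (b j)"
  shows "\<exists>g. bij_betw g A {1..card A} \<and> (\<forall>a\<in>A. \<forall>c\<in>A. (a, c) \<in> r \<longrightarrow> g a \<le> g c) \<and>
    strict_mono_on {1..n} (\<lambda>k. g (b k)) \<and> (\<forall>k\<in>{1..n}. g (b k) = card (T k))"
proof -
  have r: "r \<subseteq> A \<times> A" "refl_on A r" "trans r" "antisym r"
    using \<open>partial_order_on A r\<close> by (auto simp: partial_order_on_def preorder_on_def)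
  \<comment> \<open>The level is the index of the first layer containing \<open>a\<close>. The
    alternative \<open>k = Suc n\<close> makes the least index exist also for elements in no layer
    and puts them after all layers. Since \<open>T 0\<close> is empty, levels start at
    \<open>1\<close>.\<close>
  define level where "level a = (LEAST k. a \<in> T k \<or> k = Suc n)" for a
  \<comment> \<open>Doubling leaves room for one value between consecutive layers:
    \<open>b k\<close> gets \<open>2 * k + 1\<close>, after the rest of its layer at
    \<open>2 * k\<close> and before everything later.\<close>
  define key where "key a = 2 * level a + (if level a \<in> {1..n} \<and> a = b (level a) then 1 else 0)"
    for a
  have T_mono: "T i \<subseteq> T j" if "i \<le> j" for i j
    using that by (fastforce simp: T_def)
  have T_down: "a \<in> T k" if "(a, c) \<in> r" "c \<in> T k" for a c k
    using that r by (auto simp: T_def lower_cone_def dest: transD)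
  have level: "a \<in> T (level a) \<or> level a = Suc n" for a
    unfolding level_def by (rule LeastI[of _ "Suc n"]) simp
  have level_le: "level a \<le> k \<longleftrightarrow> a \<in> T k" if "k \<le> n" for a k
  proof
    assume "level a \<le> k"
    then show "a \<in> T k"
      using level[of a] T_mono[of "level a" k] that by auto
  qed (auto simp: level_def intro: Least_le)
  have level_mono: "level a \<le> level c" if "(a, c) \<in> r" for a c
    using level[of c] T_down[OF that, of "level c"] unfolding level_def by (auto intro: Least_le)
  have level_b: "level (b k) = k" if k: "k \<in> {1..n}" for k
  proof (rule antisym)
    have "b k \<in> T k"
      using k sub r(2) by (fastforce simp: T_def lower_cone_def refl_on_def)
    then show "level (b k) \<le> k"
      using k level_le by auto
    \<comment> \<open>If \<open>b k\<close> lies in \<open>T i\<close>, it is below some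
      \<open>b j\<close> with \<open>j \<le> i\<close>, and \<open>chain\<close> gives
      \<open>k \<le> j\<close>. So \<open>b k\<close> is in no earlier layer.\<close>
    show "k \<le> level (b k)"
      using level[of "b k"] k chain[of k]
      by (cases "level (b k) \<le> n") (fastforce simp: T_def lower_cone_def)+
  qed
  have key_mono: "key a \<le> key c" if "(a, c) \<in> r" for a c
  \<comment> \<open>The only danger is the extra \<open>1\<close> in the key of
    \<open>a = b k\<close> when \<open>c\<close> is in the same layer. Then \<open>c\<close> is
    below some \<open>b j\<close> with \<open>j \<le> k\<close>; \<open>chain\<close> forces
    \<open>j = k\<close>, and antisymmetry gives \<open>a = c\<close>.\<close>
  proof (cases "level a = level c \<and> level a \<in> {1..n} \<and> a = b (level a)")
    case True
    define k where "k = level c"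
    have k: "k \<in> {1..n}" "a = b k"
      using True unfolding k_def by metis+
    then have "c \<in> T k"
      using level[of c] by (auto simp: k_def)
    then obtain j where j: "j \<in> {1..k}" "(c, b j) \<in> r"
      by (auto simp: T_def lower_cone_def)
    then have "(b k, b j) \<in> r"
      using that k(2) \<open>trans r\<close> by (auto dest: transD)
    then have "j = k"
      using chain[of k j] j k by auto
    then have "a = c"
      using j that k(2) \<open>antisym r\<close> by (auto dest: antisymD)
    then show ?thesis by simp
  next
    case False
    then show ?thesis
      using level_mono[OF that] by (cases "level a = level c") (auto simp: key_def)
  qed
  obtain g where g: "bij_betw g A {1..card A}"
    "\<And>a c. a \<in> A \<Longrightarrow> c \<in> A \<Longrightarrow> (a, c) \<in> r \<or> key a < key c \<Longrightarrow> g a \<le> g c"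
    using linear_extension_with_key[OF \<open>finite A\<close> r(4,3), of key] key_mono by blast
  have key_b: "key (b k) = 2 * k + 1" if "k \<in> {1..n}" for k
    using level_b[OF that] that by (simp add: key_def)
  have inj_g: "g a = g c \<longleftrightarrow> a = c" if "a \<in> A" "c \<in> A" for a c
    using g(1) that by (auto simp: bij_betw_def inj_on_def)
  have b_in: "b k \<in> A" if "k \<in> {1..n}" for k
    using sub that by blast
  \<comment> \<open>\<open>T k\<close> is an initial segment for the ranks: its members other than
    \<open>b k\<close> have key at most \<open>2 * k\<close>, and elements outside it have key at
    least \<open>2 * k + 2\<close>. The rank of its last element \<open>b k\<close> is therefore its
    cardinality.\<close>
  have T_eq: "T k = {a \<in> A. g a \<le> g (b k)}" if k: "k \<in> {1..n}" for k
  proof (intro set_eqI iffI)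
    note bk = b_in[OF k]
    fix a
    {
      assume a: "a \<in> T k"
      then have "a \<in> A" by (auto simp: T_def lower_cone_def)
      moreover have "key a < 2 * k + 1 \<or> a = b k"
        using a level_le[of k a] k unfolding key_def by (cases "level a = k") auto
      ultimately show "a \<in> {a \<in> A. g a \<le> g (b k)}"
        using g(2)[OF _ bk, of a] unfolding key_b[OF k] by blast
    next
      assume a: "a \<in> {a \<in> A. g a \<le> g (b k)}"
      show "a \<in> T k"
      proof (rule ccontr)
        assume "a \<notin> T k"
        then have "2 * k + 1 < key a"
          using level_le[of k a] k unfolding key_def by auto
        then have less: "key (b k) < key a"
          using key_b[OF k] by simp
        then have "g (b k) \<le> g a"
          using g(2) a bk by auto
        then show False
          using a bk inj_g[of a "b k"] less by auto
      qed
    }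
  qed
  have card_eq: "card {a \<in> A. g a \<le> g c} = g c" if "c \<in> A" for c
  proof -
    have image: "g ` A = {1..card A}"
      using g(1) by (simp add: bij_betw_def)
    then have "g c \<le> card A"
      using that by auto
    then have "{1..g c} \<subseteq> g ` A" and "g ` A \<subseteq> {1..}"
      unfolding image by auto
    then have "g ` {a \<in> A. g a \<le> g c} = {1..g c}"
      by auto
    moreover have "inj_on g {a \<in> A. g a \<le> g c}"
      using g(1) by (auto simp: bij_betw_def inj_on_def)
    ultimately show ?thesis
      by (metis card_image card_atLeastAtMost diff_Suc_1)
  qed
  have "g (b k) = card (T k)" if "k \<in> {1..n}" for k
    unfolding T_eq[OF that] card_eq[OF b_in[OF that]] ..
  moreover have "g (b i) < g (b j)" if "i \<in> {1..n}" "j \<in> {1..n}" "i < j" for i j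
  proof -
    have "g (b i) \<le> g (b j)"
      using g(2)[OF b_in[OF that(1)] b_in[OF that(2)]] key_b[OF that(1)] key_b[OF that(2)] that(3)
      by simp
    moreover have "g (b i) \<noteq> g (b j)"
      using inj_g[OF b_in[OF that(1)] b_in[OF that(2)]] inj_on_eq_iff[OF inj that(1,2)] that(3)
      by simp
    ultimately show ?thesis by simp
  qed
  ultimately show ?thesis
    using g by (auto simp: strict_mono_on_def intro!: exI[of _ g])
qed

text \<open>Order duality: the least ranks are taken for the converse relation along the reversed
  sequence \<open>b'\<close>, and the resulting ranks are reflected by
  \<open>i \<mapsto> card A + 1 - i\<close>.\<close>

lemma greatest_ranks_along_chain:
  fixes b :: "nat \<Rightarrow> 'a"
  assumes "finite A" and "partial_order_on A r"
    and inj: "inj_on b {1..n}" and sub: "b ` {1..n} \<subseteq> A"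
    and chain: "\<And>i j. i \<in> {1..n} \<Longrightarrow> j \<in> {1..n} \<Longrightarrow> (b i, b j) \<in> r \<Longrightarrow> i \<le> j"
  defines "T \<equiv> \<lambda>k. \<Union>j\<in>{k..n}. upper_cone A r (b j)"
  shows "\<exists>g. bij_betw g A {1..card A} \<and> (\<forall>a\<in>A. \<forall>c\<in>A. (a, c) \<in> r \<longrightarrow> g a \<le> g c) \<and>
    strict_mono_on {1..n} (\<lambda>k. g (b k)) \<and> (\<forall>k\<in>{1..n}. g (b k) = card A - card (T k) + 1)"
proof -
  define b' where "b' k = b (Suc n - k)" for k
  have refl: "Suc n - k \<in> {1..n}" "b' (Suc n - k) = b k" if "k \<in> {1..n}" for k
    using that by (simp_all add: b'_def) linarith
  have "inj_on b' {1..n}"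
  proof (rule inj_onI)
    fix i j
    assume ij: "i \<in> {1..n}" "j \<in> {1..n}" "b' i = b' j"
    then have "Suc n - i = Suc n - j"
      using inj_onD[OF inj _ refl(1)[OF ij(1)] refl(1)[OF ij(2)]] by (simp add: b'_def)
    then show "i = j" using ij by auto
  qed
  moreover have "b' ` {1..n} \<subseteq> A"
    unfolding b'_def using sub refl(1) by blast
  moreover have "i \<le> j" if "i \<in> {1..n}" "j \<in> {1..n}" "(b' i, b' j) \<in> r\<inverse>" for i j
    using chain[OF refl(1)[OF that(2)] refl(1)[OF that(1)]] that by (auto simp: b'_def)
  moreover have "partial_order_on A (r\<inverse>)"
    using \<open>partial_order_on A r\<close> by simp
  ultimately obtain g where g: "bij_betw g A {1..card A}"
    "\<And>a c. a \<in> A \<Longrightarrow> c \<in> A \<Longrightarrow> (c, a) \<in> r \<Longrightarrow> g a \<le> g c"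
    "strict_mono_on {1..n} (\<lambda>k. g (b' k))"
    "\<And>k. k \<in> {1..n} \<Longrightarrow> g (b' k) = card (\<Union>j\<in>{1..k}. lower_cone A (r\<inverse>) (b' j))"
    using least_ranks_along_chain[of A "r\<inverse>" b' n] \<open>finite A\<close> unfolding converse_iff by metis
  define g' where "g' a = Suc (card A) - g a" for a
  have b_in: "b k \<in> A" if "k \<in> {1..n}" for k
    using sub that by blast
  have range: "g a \<in> {1..card A}" if "a \<in> A" for a
    using g(1) that by (auto simp: bij_betw_def)
  have "bij_betw (\<lambda>i. Suc (card A) - i) {1..card A} {1..card A}"
    by (rule bij_betwI[of _ _ _ "\<lambda>i. Suc (card A) - i"]) auto
  then have "bij_betw g' A {1..card A}"
    using bij_betw_trans[OF g(1)] by (simp add: g'_def[abs_def] comp_def)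
  moreover have "g' a \<le> g' c" if "a \<in> A" "c \<in> A" "(a, c) \<in> r" for a c
    using g(2)[of c a] that by (auto simp: g'_def)
  moreover have "g' (b i) < g' (b j)" if "i \<in> {1..n}" "j \<in> {1..n}" "i < j" for i j
  proof -
    have "g (b j) < g (b i)"
      using strict_mono_onD[OF g(3) refl(1)[OF that(2)] refl(1)[OF that(1)]] refl(2) that by auto
    then show ?thesis
      using range[OF b_in[OF that(1)]] by (auto simp: g'_def)
  qed
  moreover have "g' (b k) = card A - card (T k) + 1" if k: "k \<in> {1..n}" for k
  proof -
    \<comment> \<open>Lower cones of the converse are upper cones of \<open>r\<close>, and
      \<open>j \<mapsto> Suc n - j\<close> exchanges \<open>{1..Suc n - k}\<close> with
      \<open>{k..n}\<close>.\<close>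
    have "(\<Union>j\<in>{1..Suc n - k}. lower_cone A (r\<inverse>) (b' j)) = T k"
    proof (intro set_eqI iffI)
      fix a assume "a \<in> (\<Union>j\<in>{1..Suc n - k}. lower_cone A (r\<inverse>) (b' j))"
      then obtain j where "j \<in> {1..Suc n - k}" "a \<in> A" "(b (Suc n - j), a) \<in> r"
        by (auto simp: lower_cone_def b'_def)
      then show "a \<in> T k"
        using k by (auto simp: T_def upper_cone_def intro!: bexI[of _ "Suc n - j"])
    next
      fix a assume "a \<in> T k"
      then obtain j where "j \<in> {k..n}" "a \<in> A" "(b j, a) \<in> r"
        by (auto simp: T_def upper_cone_def)
      then show "a \<in> (\<Union>j\<in>{1..Suc n - k}. lower_cone A (r\<inverse>) (b' j))"
        using k by (auto simp: lower_cone_def b'_def intro!: bexI[of _ "Suc n - j"])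
    qed
    then have "g (b k) = card (T k)"
      using g(4)[OF refl(1)[OF k]] refl(2)[OF k] by simp
    \<comment> \<open>\<open>range\<close> bounds \<open>card (T k)\<close> by
      \<open>card A\<close>, so truncated subtraction does no harm and
      \<open>Suc (card A) - card (T k)\<close> is \<open>card A - card (T k) + 1\<close>.\<close>
    then show ?thesis
      using range[OF b_in[OF k]] by (auto simp: g'_def)
  qed
  ultimately show ?thesis
    by (auto simp: strict_mono_on_def intro!: exI[of _ g'])
qed

section \<open>Sorting permutations, and the correspondence between rank functions and members of
  \<open>F\<close>\<close>

text \<open>A linear extension of the empty relation with key \<open>h\<close> assigns to each index
  its position in the sorted order; the inverse of that map is the permutation sought.\<close>

lemma obtain_sorting_permutation:
  fixes h :: "nat \<Rightarrow> 'x::linorder"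
  assumes "inj_on h {1..n}"
  obtains \<pi> where "\<pi> permutes {1..n}" and "strict_mono_on {1..n} (\<lambda>k. h (\<pi> k))"
proof -
  obtain g where g: "bij_betw g {1..n} {1..n}"
    "\<And>i j. i \<in> {1..n} \<Longrightarrow> j \<in> {1..n} \<Longrightarrow> h i < h j \<Longrightarrow> g i \<le> g j"
    using linear_extension_with_key[of "{1..n}" "{}" h] by auto
  \<comment> \<open>Outside \<open>{1..n}\<close> the value is the identity, as
    \<open>permutes\<close> demands.\<close>
  define \<pi> where "\<pi> k = (if k \<in> {1..n} then inv_into {1..n} g k else k)" for k
  have "bij_betw \<pi> {1..n} {1..n}"
    using bij_betw_inv_into[OF g(1)]
    by (rule bij_betw_cong[THEN iffD1, rotated]) (auto simp: \<pi>_def)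
  then have perm: "\<pi> permutes {1..n}"
    by (rule bij_imp_permutes) (auto simp: \<pi>_def)
  have \<pi>: "\<pi> k \<in> {1..n}" "g (\<pi> k) = k" if "k \<in> {1..n}" for k
    using that permutes_in_image[OF perm, of k] bij_betw_inv_into_right[OF g(1) that]
    by (simp_all add: \<pi>_def)
  have "h (\<pi> i) < h (\<pi> j)" if "i \<in> {1..n}" "j \<in> {1..n}" "i < j" for i j
  proof -
    have "\<pi> i \<noteq> \<pi> j"
      using \<pi>(2)[OF that(1)] \<pi>(2)[OF that(2)] that(3) by auto
    then have "h (\<pi> i) \<noteq> h (\<pi> j)"
      using inj_on_eq_iff[OF assms \<pi>(1)[OF that(1)] \<pi>(1)[OF that(2)]] by simp
    moreover have "\<not> h (\<pi> j) < h (\<pi> i)"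
      using g(2)[OF \<pi>(1)[OF that(2)] \<pi>(1)[OF that(1)]] \<pi>(2)[OF that(1)] \<pi>(2)[OF that(2)] that(3)
      by linarith
    ultimately show ?thesis by auto
  qed
  then show thesis
    using that[OF perm] by (auto simp: strict_mono_on_def)
qed

text \<open>Composition with \<xi> turns an order-preserving ranking into a member of
  \<open>F\<close>; the restriction makes it extensional. The passage back, by inverting \<xi>, is
  \<open>obtain_rank_of_F\<close>.\<close>

lemma restrict_rank_in_F:
  assumes "strict_mono_on {1..N} \<xi>" and "bij_betw g A {1..N}"
    and "\<And>a c. a \<in> A \<Longrightarrow> c \<in> A \<Longrightarrow> (a, c) \<in> r \<Longrightarrow> g a \<le> g c"
  shows "restrict (\<xi> \<circ> g) A \<in> F A r N \<xi>"
proof -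
  have "bij_betw \<xi> {1..N} (\<xi> ` {1..N})"
    using assms(1) by (simp add: bij_betw_def strict_mono_on_imp_inj_on)
  then have "bij_betw (\<xi> \<circ> g) A (\<xi> ` {1..N})"
    using assms(2) by (rule bij_betw_trans[rotated])
  then have "bij_betw (restrict (\<xi> \<circ> g) A) A (\<xi> ` {1..N})"
    by (rule bij_betw_cong[THEN iffD1, rotated]) simp
  moreover have "\<xi> (g a) \<le> \<xi> (g c)" if "a \<in> A" "c \<in> A" "(a, c) \<in> r" for a c
    using assms that
    by (intro monotone_onD[OF strict_mono_on_imp_mono_on[OF assms(1)]]) (auto simp: bij_betw_def)
  ultimately show ?thesis
    by (simp add: F_def)
qed

lemma obtain_rank_of_F:
  assumes "strict_mono_on {1..N} \<xi>" and "f \<in> F A r N \<xi>"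
  obtains g where "bij_betw g A {1..N}" and "\<And>a. a \<in> A \<Longrightarrow> f a = \<xi> (g a)"
    and "\<And>a c. a \<in> A \<Longrightarrow> c \<in> A \<Longrightarrow> g a \<le> g c \<longleftrightarrow> f a \<le> f c"
proof -
  define g where "g = inv_into {1..N} \<xi> \<circ> f"
  have \<xi>: "bij_betw \<xi> {1..N} (\<xi> ` {1..N})"
    using assms(1) by (simp add: bij_betw_def strict_mono_on_imp_inj_on)
  have f: "bij_betw f A (\<xi> ` {1..N})"
    using assms(2) by (simp add: F_def)
  have bij: "bij_betw g A {1..N}"
    unfolding g_def using f bij_betw_inv_into[OF \<xi>] by (rule bij_betw_trans)
  moreover have fg: "f a = \<xi> (g a)" if "a \<in> A" for a
    using bij_betw_inv_into_right[OF \<xi> bij_betwE[OF f, rule_format, OF that]] by (simp add: g_def)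
  moreover have "g a \<le> g c \<longleftrightarrow> f a \<le> f c" if "a \<in> A" "c \<in> A" for a c
    using strict_mono_on_less_eq[OF assms(1) bij_betwE[OF bij, rule_format, OF that(1)]
        bij_betwE[OF bij, rule_format, OF that(2)]] fg that
    by simp
  ultimately show thesis by (rule that)
qed

text \<open>Extensionality places \<open>F\<close> inside a finite function space, so that
  \<open>Min\<close> and \<open>Max\<close> over it are genuine extrema.\<close>

lemma finite_F:
  assumes "finite A"
  shows "finite (F A r N \<xi>)"
proof (rule finite_subset)
  show "F A r N \<xi> \<subseteq> A \<rightarrow>\<^sub>E \<xi> ` {1..N}"
    by (auto simp: F_def PiE_def bij_betw_def)
qed (use assms in \<open>auto intro: finite_PiE\<close>)

section \<open>Bounds for the values of functions in \<open>F_perm\<close>, and their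
  attainment\<close>

text \<open>A counting argument: the rank function \<open>g\<close> of \<open>f\<close> maps
  \<open>?L\<close> injectively into \<open>{1..g ?x}\<close> and \<open>?U\<close> injectively into
  \<open>{g ?x..N}\<close>. Comparing cardinalities bounds \<open>g ?x\<close> on both sides, and
  \<xi> carries the bounds over to \<open>f\<close>.\<close>

lemma F_perm_bounds:
  fixes \<xi> :: "nat \<Rightarrow> 'x::linorder"
  assumes "finite A" and "card A = N" and "partial_order_on A r" and \<xi>: "strict_mono_on {1..N} \<xi>"
    and \<pi>: "\<pi> permutes {1..n}" and sub: "\<beta> ` {1..n} \<subseteq> A"
    and f: "f \<in> F_perm A r N \<xi> \<beta> n \<pi>" and k: "k \<in> {1..n}"
  shows "\<xi> (card (T_lower A r \<beta> \<pi> k)) \<le> f (\<beta> (\<pi> k))"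
    and "f (\<beta> (\<pi> k)) \<le> \<xi> (N - card (T_upper A r \<beta> n \<pi> k) + 1)"
proof -
  have fF: "f \<in> F A r N \<xi>" and f_mono: "strict_mono_on {1..n} (\<lambda>k. f (\<beta> (\<pi> k)))"
    using f by (auto simp: F_perm_def)
  have r_mono: "f a \<le> f c" if "a \<in> A" "c \<in> A" "(a, c) \<in> r" for a c
    using fF that by (auto simp: F_def)
  have b: "\<beta> (\<pi> j) \<in> A" if "j \<in> {1..n}" for j
    using permutes_in_image[OF \<pi>, of j] sub that by blast
  have f_le: "f (\<beta> (\<pi> i)) \<le> f (\<beta> (\<pi> j))" if "i \<in> {1..n}" "j \<in> {1..n}" "i \<le> j" for i j
    using strict_mono_on_leD[OF f_mono that] .
  obtain g where g: "bij_betw g A {1..N}" "\<And>a. a \<in> A \<Longrightarrow> f a = \<xi> (g a)"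
    "\<And>a c. a \<in> A \<Longrightarrow> c \<in> A \<Longrightarrow> g a \<le> g c \<longleftrightarrow> f a \<le> f c"
    using obtain_rank_of_F[OF \<xi> fF] by blast
  have \<xi>_mono: "\<xi> i \<le> \<xi> j" if "i \<in> {1..N}" "j \<in> {1..N}" "i \<le> j" for i j
    using strict_mono_on_leD[OF \<xi> that] .
  have range: "g a \<in> {1..N}" if "a \<in> A" for a
    using g(1) that by (auto simp: bij_betw_def)
  have inj: "inj_on g C" if "C \<subseteq> A" for C
    using g(1) that by (auto simp: bij_betw_def intro: inj_on_subset)
  have refl: "(\<beta> (\<pi> k), \<beta> (\<pi> k)) \<in> r"
    using \<open>partial_order_on A r\<close> b[OF k] by (auto simp: partial_order_on_def preorder_on_def refl_on_def)

  let ?L = "T_lower A r \<beta> \<pi> k" and ?U = "T_upper A r \<beta> n \<pi> k" and ?x = "\<beta> (\<pi> k)"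
  have sub_A: "?L \<subseteq> A" "?U \<subseteq> A"
    by (auto simp: T_lower_def T_upper_def lower_cone_def upper_cone_def)
  have mem: "?x \<in> ?L" "?x \<in> ?U"
    using k refl b[OF k]
    by (auto simp: T_lower_def T_upper_def lower_cone_def upper_cone_def intro!: bexI[of _ k])
  \<comment> \<open>Positive cardinalities keep both indices, \<open>card ?L\<close> and
    \<open>N - card ?U + 1\<close>, inside \<open>{1..N}\<close>, where \<xi> is known to be
    monotone.\<close>
  have pos: "card ?L > 0" "card ?U > 0"
    using mem sub_A \<open>finite A\<close> by (auto simp: card_gt_0_iff intro: finite_subset)
  have "g a \<le> g ?x" if "a \<in> ?L" for a
  proof -
    obtain j where j: "j \<in> {1..k}" "a \<in> A" "(a, \<beta> (\<pi> j)) \<in> r"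
      using \<open>a \<in> ?L\<close> by (auto simp: T_lower_def lower_cone_def)
    then have "f a \<le> f ?x"
      using r_mono[OF j(2) b j(3)] f_le[of j k] k by auto
    then show ?thesis
      using g(3) j(2) b[OF k] by simp
  qed
  then have "g ` ?L \<subseteq> {1..g ?x}"
    using range sub_A by fastforce
  then have "card ?L \<le> g ?x"
    using card_mono[of "{1..g ?x}" "g ` ?L"] by (simp add: card_image inj sub_A)
  then show "\<xi> (card ?L) \<le> f ?x"
    using g(2)[OF b[OF k]] range[OF b[OF k]] pos by (auto intro!: \<xi>_mono)

  have "g ?x \<le> g a" if "a \<in> ?U" for a
  proof -
    obtain j where j: "j \<in> {k..n}" "a \<in> A" "(\<beta> (\<pi> j), a) \<in> r"
      using \<open>a \<in> ?U\<close> by (auto simp: T_upper_def upper_cone_def)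
    then have "f ?x \<le> f a"
      using r_mono[OF b j(2) j(3)] f_le[of k j] k by auto
    then show ?thesis
      using g(3) j(2) b[OF k] by simp
  qed
  then have "g ` ?U \<subseteq> {g ?x..N}"
    using range sub_A by fastforce
  then have "card ?U \<le> Suc N - g ?x"
    using card_mono[of "{g ?x..N}" "g ` ?U"] by (simp add: card_image inj sub_A)
  then show "f ?x \<le> \<xi> (N - card ?U + 1)"
    using g(2)[OF b[OF k]] range[OF b[OF k]] pos by (auto intro!: \<xi>_mono)
qed

text \<open>Admissibility of \<pi> makes \<open>b\<close>, the composite of \<beta> and \<pi>, a
  sequence to which the extremal linear extensions apply. One function meets the bounds for all
  \<open>k\<close> at once, which the statement about sums requires.\<close>

lemma F_perm_attains_bounds:
  fixes \<xi> :: "nat \<Rightarrow> 'x::linorder"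
  assumes "finite A" and "card A = N" and "partial_order_on A r" and \<xi>: "strict_mono_on {1..N} \<xi>"
    and \<pi>: "\<pi> \<in> admissible_perms r \<beta> n" and inj: "inj_on \<beta> {1..n}" and sub: "\<beta> ` {1..n} \<subseteq> A"
  shows "\<exists>f\<in>F_perm A r N \<xi> \<beta> n \<pi>. \<forall>k\<in>{1..n}. f (\<beta> (\<pi> k)) = \<xi> (card (T_lower A r \<beta> \<pi> k))"
    and "\<exists>f\<in>F_perm A r N \<xi> \<beta> n \<pi>. \<forall>k\<in>{1..n}.
      f (\<beta> (\<pi> k)) = \<xi> (N - card (T_upper A r \<beta> n \<pi> k) + 1)"
proof -
  define b where "b k = \<beta> (\<pi> k)" for k
  have perm: "\<pi> permutes {1..n}"
    and adm: "\<And>i j. i \<in> {1..n} \<Longrightarrow> j \<in> {1..n} \<Longrightarrow> (b i, b j) \<in> r \<Longrightarrow> b i \<noteq> b j \<Longrightarrow> i < j"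
    using \<pi> unfolding admissible_perms_def b_def by blast+
  have image: "\<pi> ` {1..n} = {1..n}"
    using perm by (rule permutes_image)
  have inj_b: "inj_on b {1..n}"
    using comp_inj_on[OF permutes_inj_on[OF perm], of \<beta> "{1..n}"] inj
    by (simp only: image b_def[abs_def] comp_def)
  have sub_b: "b ` {1..n} \<subseteq> A"
    using sub image by (auto simp: b_def)
  \<comment> \<open>Admissibility speaks of distinct elements only; when \<open>b i = b j\<close>,
    injectivity gives \<open>i = j\<close>.\<close>
  have chain: "i \<le> j" if "i \<in> {1..n}" "j \<in> {1..n}" "(b i, b j) \<in> r" for i j
    using adm[OF that] inj_onD[OF inj_b _ that(1,2)] by (cases "b i = b j") simp_all
  have transfer: "restrict (\<xi> \<circ> g) A \<in> F_perm A r N \<xi> \<beta> n \<pi>"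
    "\<forall>k\<in>{1..n}. restrict (\<xi> \<circ> g) A (\<beta> (\<pi> k)) = \<xi> (g (b k))"
    if g: "bij_betw g A {1..N}" "\<forall>a\<in>A. \<forall>c\<in>A. (a, c) \<in> r \<longrightarrow> g a \<le> g c"
      "strict_mono_on {1..n} (\<lambda>k. g (b k))" for g
  proof -
    show eq: "\<forall>k\<in>{1..n}. restrict (\<xi> \<circ> g) A (\<beta> (\<pi> k)) = \<xi> (g (b k))"
      using sub_b by (auto simp: b_def)
    have range: "g (b k) \<in> {1..N}" if "k \<in> {1..n}" for k
      using bij_betwE[OF g(1)] sub_b that by blast
    have "strict_mono_on {1..n} (\<lambda>k. restrict (\<xi> \<circ> g) A (\<beta> (\<pi> k)))"
    proof (rule strict_mono_onI)
      fix i j :: nat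
      assume ij: "i \<in> {1..n}" "j \<in> {1..n}" "i < j"
      have "\<xi> (g (b i)) < \<xi> (g (b j))"
        using strict_mono_onD[OF \<xi> range[OF ij(1)] range[OF ij(2)]] strict_mono_onD[OF g(3) ij] .
      then show "restrict (\<xi> \<circ> g) A (\<beta> (\<pi> i)) < restrict (\<xi> \<circ> g) A (\<beta> (\<pi> j))"
        using eq ij by simp
    qed
    then show "restrict (\<xi> \<circ> g) A \<in> F_perm A r N \<xi> \<beta> n \<pi>"
      using restrict_rank_in_F[OF \<xi> g(1)] g(2) by (simp add: F_perm_def)
  qed
  obtain g where g: "bij_betw g A {1..N}" "\<forall>a\<in>A. \<forall>c\<in>A. (a, c) \<in> r \<longrightarrow> g a \<le> g c"
    "strict_mono_on {1..n} (\<lambda>k. g (b k))"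
    and gk: "\<forall>k\<in>{1..n}. g (b k) = card (T_lower A r \<beta> \<pi> k)"
    using least_ranks_along_chain[OF assms(1,3) inj_b sub_b chain]
    unfolding T_lower_def b_def[symmetric] \<open>card A = N\<close> by blast
  show "\<exists>f\<in>F_perm A r N \<xi> \<beta> n \<pi>. \<forall>k\<in>{1..n}. f (\<beta> (\<pi> k)) = \<xi> (card (T_lower A r \<beta> \<pi> k))"
    using transfer[OF g] gk by (intro bexI[of _ "restrict (\<xi> \<circ> g) A"]) auto
  obtain g where g: "bij_betw g A {1..N}" "\<forall>a\<in>A. \<forall>c\<in>A. (a, c) \<in> r \<longrightarrow> g a \<le> g c"
    "strict_mono_on {1..n} (\<lambda>k. g (b k))"
    and gk: "\<forall>k\<in>{1..n}. g (b k) = N - card (T_upper A r \<beta> n \<pi> k) + 1"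
    using greatest_ranks_along_chain[OF assms(1,3) inj_b sub_b chain]
    unfolding T_upper_def b_def[symmetric] \<open>card A = N\<close> by blast
  show "\<exists>f\<in>F_perm A r N \<xi> \<beta> n \<pi>. \<forall>k\<in>{1..n}.
      f (\<beta> (\<pi> k)) = \<xi> (N - card (T_upper A r \<beta> n \<pi> k) + 1)"
    using transfer[OF g] gk by (intro bexI[of _ "restrict (\<xi> \<circ> g) A"]) auto
qed

section \<open>Decomposition of \<open>F\<close> into the sets \<open>F_perm\<close>, and the
  resulting extrema\<close>

text \<open>A function in \<open>F\<close> is injective on the chosen elements, so sorting its
  values there yields a permutation; that the function is non-decreasing makes this permutation
  admissible.\<close>

lemma F_eq_Union_F_perm:
  assumes inj: "inj_on \<beta> {1..n}" and sub: "\<beta> ` {1..n} \<subseteq> A"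
  shows "F A r N \<xi> = (\<Union>\<pi>\<in>admissible_perms r \<beta> n. F_perm A r N \<xi> \<beta> n \<pi>)"
proof (intro set_eqI iffI)
  fix f assume f: "f \<in> F A r N \<xi>"
  then have "inj_on f A"
    by (auto simp: F_def bij_betw_def)
  then have "inj_on (\<lambda>k. f (\<beta> k)) {1..n}"
    using comp_inj_on[OF inj, of f] sub by (simp add: comp_def inj_on_subset)
  then obtain \<pi> where \<pi>: "\<pi> permutes {1..n}" "strict_mono_on {1..n} (\<lambda>k. f (\<beta> (\<pi> k)))"
    by (rule obtain_sorting_permutation)
  have "i < j" if "i \<in> {1..n}" "j \<in> {1..n}" "(\<beta> (\<pi> i), \<beta> (\<pi> j)) \<in> r" "\<beta> (\<pi> i) \<noteq> \<beta> (\<pi> j)"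
    for i j
  proof -
    have "\<pi> i \<in> {1..n}" "\<pi> j \<in> {1..n}"
      using that permutes_in_image[OF \<pi>(1)] by blast+
    then have "\<beta> (\<pi> i) \<in> A" "\<beta> (\<pi> j) \<in> A"
      using sub by auto
    then have "f (\<beta> (\<pi> i)) \<le> f (\<beta> (\<pi> j))"
      using f that(3) by (auto simp: F_def)
    then have "i \<le> j"
      using strict_mono_on_less_eq[OF \<pi>(2) that(1,2)] by simp
    then show ?thesis
      using that(4) by (cases "i = j") auto
  qed
  then have "\<pi> \<in> admissible_perms r \<beta> n"
    using \<pi>(1) by (auto simp: admissible_perms_def)
  moreover have "f \<in> F_perm A r N \<xi> \<beta> n \<pi>"
    using f \<pi>(2) by (simp add: F_perm_def)
  ultimately show "f \<in> (\<Union>\<pi>\<in>admissible_perms r \<beta> n. F_perm A r N \<xi> \<beta> n \<pi>)"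
    by blast
qed (auto simp: F_perm_def)

text \<open>The nonemptiness claims, together with finiteness, ensure that \<open>Min\<close> and
  \<open>Max\<close> are attained extrema. For \<open>n = 0\<close> every sum is the same
  unspecified constant, so the identities still hold.\<close>

theorem theorem3:
  fixes A :: "'a set" and r :: "'a rel" and N n :: nat
    and \<xi> :: "nat \<Rightarrow> 'x::{linorder, ab_semigroup_add}"
    and \<beta> :: "nat \<Rightarrow> 'a"
  assumes add_strict: "\<And>x y z :: 'x. x < y \<Longrightarrow> x + z < y + z"
    and "finite A" and "card A = N"
    and "partial_order_on A r"
    and "strict_mono_on {1..N} \<xi>"
    and "n \<le> N" and "inj_on \<beta> {1..n}" and "\<beta> ` {1..n} \<subseteq> A"
  shows
    "(\<forall>\<pi>\<in>admissible_perms r \<beta> n.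
        F_perm A r N \<xi> \<beta> n \<pi> \<noteq> {} \<and>
        Min (S \<beta> n ` F_perm A r N \<xi> \<beta> n \<pi>)
          = semigroup_sum (\<lambda>k. \<xi> (card (T_lower A r \<beta> \<pi> k))) n \<and>
        Max (S \<beta> n ` F_perm A r N \<xi> \<beta> n \<pi>)
          = semigroup_sum (\<lambda>k. \<xi> (N - card (T_upper A r \<beta> n \<pi> k) + 1)) n \<and>
        (\<forall>f\<in>F_perm A r N \<xi> \<beta> n \<pi>.
           S \<beta> n f = Min (S \<beta> n ` F_perm A r N \<xi> \<beta> n \<pi>) \<longrightarrow>
           (\<forall>k\<in>{1..n}. f (\<beta> (\<pi> k)) = \<xi> (card (T_lower A r \<beta> \<pi> k)))) \<and>
        (\<forall>f\<in>F_perm A r N \<xi> \<beta> n \<pi>.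
           S \<beta> n f = Max (S \<beta> n ` F_perm A r N \<xi> \<beta> n \<pi>) \<longrightarrow>
           (\<forall>k\<in>{1..n}. f (\<beta> (\<pi> k)) = \<xi> (N - card (T_upper A r \<beta> n \<pi> k) + 1)))) \<and>
     F A r N \<xi> \<noteq> {} \<and> admissible_perms r \<beta> n \<noteq> {} \<and>
     Min (S \<beta> n ` F A r N \<xi>)
       = Min ((\<lambda>\<pi>. semigroup_sum (\<lambda>k. \<xi> (card (T_lower A r \<beta> \<pi> k))) n)
               ` admissible_perms r \<beta> n) \<and>
     Max (S \<beta> n ` F A r N \<xi>)
       = Max ((\<lambda>\<pi>. semigroup_sum (\<lambda>k. \<xi> (N - card (T_upper A r \<beta> n \<pi> k) + 1)) n)
               ` admissible_perms r \<beta> n)"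
proof -
  let ?P = "admissible_perms r \<beta> n"
  let ?Fp = "F_perm A r N \<xi> \<beta> n"
  let ?l = "\<lambda>\<pi> k. \<xi> (card (T_lower A r \<beta> \<pi> k))"
  let ?u = "\<lambda>\<pi> k. \<xi> (N - card (T_upper A r \<beta> n \<pi> k) + 1)"
  have fin_F: "finite (F A r N \<xi>)"
    using \<open>finite A\<close> by (rule finite_F)
  have fin_Fp: "finite (?Fp \<pi>)" for \<pi>
    by (rule finite_subset[OF _ fin_F]) (auto simp: F_perm_def)
  have fin_P: "finite ?P"
    by (rule finite_subset[OF _ finite_permutations[of "{1..n}"]]) (auto simp: admissible_perms_def)
  have F_eq: "F A r N \<xi> = (\<Union>\<pi>\<in>?P. ?Fp \<pi>)"
    using assms(7,8) by (rule F_eq_Union_F_perm)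
  have perm: "\<pi> permutes {1..n}" if "\<pi> \<in> ?P" for \<pi>
    using that by (simp add: admissible_perms_def)
  \<comment> \<open>Reordering the sum along \<pi> aligns its terms with those of \<open>?l\<close>
    and \<open>?u\<close>, so that they can be compared one by one.\<close>
  have S_eq: "S \<beta> n f = semigroup_sum (\<lambda>k. f (\<beta> (\<pi> k))) n" if "\<pi> \<in> ?P" for \<pi> and f :: "'a \<Rightarrow> 'x"
    using semigroup_sum_permute[OF perm[OF that], of "\<lambda>k. f (\<beta> k)"] by (simp add: S_def)
  note bounds = F_perm_bounds[OF assms(2-5) perm assms(8)]
  note attain = F_perm_attains_bounds[OF assms(2-5) _ assms(7,8)]

  have Sl: "semigroup_sum (?l \<pi>) n \<le> S \<beta> n f" and Su: "S \<beta> n f \<le> semigroup_sum (?u \<pi>) n"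
    if "\<pi> \<in> ?P" "f \<in> ?Fp \<pi>" for \<pi> f
    unfolding S_eq[OF that(1)]
    using bounds[OF that] by (auto intro!: semigroup_sum_mono[OF add_strict])
  have eq_l: "f (\<beta> (\<pi> k)) = ?l \<pi> k"
    if "\<pi> \<in> ?P" "f \<in> ?Fp \<pi>" "S \<beta> n f = semigroup_sum (?l \<pi>) n" "k \<in> {1..n}" for \<pi> f k
    using semigroup_sum_eq_imp_eq[where n = n and i = k and g = "?l \<pi>" and
        h = "\<lambda>k. f (\<beta> (\<pi> k))", OF add_strict _ _ that(4)] bounds(1)[OF that(1,2)] that(3)
    unfolding S_eq[OF that(1)] by metis
  have eq_u: "f (\<beta> (\<pi> k)) = ?u \<pi> k"
    if "\<pi> \<in> ?P" "f \<in> ?Fp \<pi>" "S \<beta> n f = semigroup_sum (?u \<pi>) n" "k \<in> {1..n}" for \<pi> f k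
    using semigroup_sum_eq_imp_eq[where n = n and i = k and g = "\<lambda>k. f (\<beta> (\<pi> k))" and
        h = "?u \<pi>", OF add_strict _ _ that(4)] bounds(2)[OF that(1,2)] that(3)
    unfolding S_eq[OF that(1)] by metis
  have att_l: "\<exists>f\<in>?Fp \<pi>. S \<beta> n f = semigroup_sum (?l \<pi>) n" if "\<pi> \<in> ?P" for \<pi>
    using attain(1)[OF that] unfolding S_eq[OF that]
    by (auto intro!: semigroup_sum_cong elim!: bexE rev_bexI)
  have att_u: "\<exists>f\<in>?Fp \<pi>. S \<beta> n f = semigroup_sum (?u \<pi>) n" if "\<pi> \<in> ?P" for \<pi>
    using attain(2)[OF that] unfolding S_eq[OF that]
    by (auto intro!: semigroup_sum_cong elim!: bexE rev_bexI)
  have Fp_ne: "?Fp \<pi> \<noteq> {}" if "\<pi> \<in> ?P" for \<pi>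
    using att_l[OF that] by blast
  have min_Fp: "Min (S \<beta> n ` ?Fp \<pi>) = semigroup_sum (?l \<pi>) n" if "\<pi> \<in> ?P" for \<pi>
    using att_l[OF that] Sl[OF that] fin_Fp by (intro Min_eqI) (force simp: image_iff)+
  have max_Fp: "Max (S \<beta> n ` ?Fp \<pi>) = semigroup_sum (?u \<pi>) n" if "\<pi> \<in> ?P" for \<pi>
    using att_u[OF that] Su[OF that] fin_Fp by (intro Max_eqI) (force simp: image_iff)+

  have r: "antisym r" "trans r"
    using \<open>partial_order_on A r\<close> by (auto simp: partial_order_on_def preorder_on_def)
  \<comment> \<open>With a constant key this is a plain linear extension. It shows that
    \<open>F\<close> is nonempty, and the decomposition of \<open>F\<close> then supplies an
    admissible permutation.\<close>
  obtain g where g: "bij_betw g A {1..N}" "\<And>a c. a \<in> A \<Longrightarrow> c \<in> A \<Longrightarrow> (a, c) \<in> r \<Longrightarrow> g a \<le> g c"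
    using linear_extension_with_key[OF \<open>finite A\<close> r, of "\<lambda>_. 0 :: nat"] \<open>card A = N\<close> by auto
  have F_ne: "F A r N \<xi> \<noteq> {}"
    using restrict_rank_in_F[OF assms(5) g] by blast
  then have P_ne: "?P \<noteq> {}"
    by (auto simp: F_eq)
  \<comment> \<open>The minimum over a union is the least of the minima: the smallest
    \<open>?l\<close>-sum is attained in its own \<open>F_perm\<close>, and any \<open>f\<close> in
    \<open>F\<close> lies in some \<open>F_perm\<close>, whose \<open>?l\<close>-sum is a lower
    bound for \<open>f\<close>.\<close>
  have "Min (S \<beta> n ` F A r N \<xi>) = Min ((\<lambda>\<pi>. semigroup_sum (?l \<pi>) n) ` ?P)"
  proof (rule Min_eqI)
    have "Min ((\<lambda>\<pi>. semigroup_sum (?l \<pi>) n) ` ?P) \<in> (\<lambda>\<pi>. semigroup_sum (?l \<pi>) n) ` ?P"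
      using fin_P P_ne by (intro Min_in) auto
    then obtain \<pi> f where "\<pi> \<in> ?P" "f \<in> ?Fp \<pi>"
      "S \<beta> n f = Min ((\<lambda>\<pi>. semigroup_sum (?l \<pi>) n) ` ?P)"
      using att_l by (metis (no_types, lifting) imageE)
    then show "Min ((\<lambda>\<pi>. semigroup_sum (?l \<pi>) n) ` ?P) \<in> S \<beta> n ` F A r N \<xi>"
      unfolding F_eq by (metis UN_I image_eqI)
    fix y assume "y \<in> S \<beta> n ` F A r N \<xi>"
    then obtain \<pi> f where "\<pi> \<in> ?P" "f \<in> ?Fp \<pi>" "y = S \<beta> n f"
      by (auto simp: F_eq)
    then show "Min ((\<lambda>\<pi>. semigroup_sum (?l \<pi>) n) ` ?P) \<le> y"
      using Sl fin_P by (intro order.trans[OF Min_le]) auto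
  qed (use fin_F in simp)
  moreover have "Max (S \<beta> n ` F A r N \<xi>) = Max ((\<lambda>\<pi>. semigroup_sum (?u \<pi>) n) ` ?P)"
  proof (rule Max_eqI)
    have "Max ((\<lambda>\<pi>. semigroup_sum (?u \<pi>) n) ` ?P) \<in> (\<lambda>\<pi>. semigroup_sum (?u \<pi>) n) ` ?P"
      using fin_P P_ne by (intro Max_in) auto
    then obtain \<pi> f where "\<pi> \<in> ?P" "f \<in> ?Fp \<pi>"
      "S \<beta> n f = Max ((\<lambda>\<pi>. semigroup_sum (?u \<pi>) n) ` ?P)"
      using att_u by (metis (no_types, lifting) imageE)
    then show "Max ((\<lambda>\<pi>. semigroup_sum (?u \<pi>) n) ` ?P) \<in> S \<beta> n ` F A r N \<xi>"
      unfolding F_eq by (metis UN_I image_eqI)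
    fix y assume "y \<in> S \<beta> n ` F A r N \<xi>"
    then obtain \<pi> f where "\<pi> \<in> ?P" "f \<in> ?Fp \<pi>" "y = S \<beta> n f"
      by (auto simp: F_eq)
    then show "y \<le> Max ((\<lambda>\<pi>. semigroup_sum (?u \<pi>) n) ` ?P)"
      using fin_P by (auto intro: order.trans[OF Su Max_ge])
  qed (use fin_F in simp)
  ultimately show ?thesis
    by (intro conjI ballI impI) (simp_all only: Fp_ne min_Fp max_Fp eq_l eq_u F_ne P_ne not_False_eq_True)
qed

end
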